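(* For every integer $m\ge0$ the polynomial $$\mathcal B_{2m+2}(\phi)=-2^{2m+1}\sum_{k=0}^{m+1}(2\pi i)^{2k}\,\frac{B_{2k}}{(2k)!}\,\frac{B^{(2m+2)}_{2m+2-2k}(m+1)}{(2m+2-2k)!}\,\phi^{2m+2-2k}$$ vanishes at $\phi=2\pi i$ and at $\phi=-2\pi i$. Equivalently, $$\sum_{k=0}^{m+1}\frac{B_{2k}\,B_{2m+2-2k}^{(2m+2)}(m+1)}{(2k)!\,(2m+2-2k)!}=0 .$$
   Context: $B_{2k}$ are the Bernoulli numbers and $B^{(m)}_n(t)$ the generalized Bernoulli polynomials, defined by $\left(\frac{x}{e^x-1}\right)^m e^{tx}=\sum_{n\ge0}\frac{B^{(m)}_n(t)}{n!}x^n$. *)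

theory Defs
  imports Complex_Main "HOL-Computational_Algebra.Computational_Algebra"
begin

(* Both series have subdegree 1, so the fps quotient is the usual x / (e^x - 1),
   see bernoulli_gf_mult. *)
definition bernoulli_gf :: "'a :: field_char_0 fps" where
  "bernoulli_gf = fps_X / (fps_exp 1 - 1)"

lemma bernoulli_gf_mult:
  "bernoulli_gf * (fps_exp 1 - 1) = (fps_X :: 'a :: field_char_0 fps)"
proof -
  have nth1: "fps_nth (fps_exp 1 - 1 :: 'a fps) 1 \<noteq> 0" by simp
  then have nz: "(fps_exp 1 - 1 :: 'a fps) \<noteq> 0" by (metis fps_zero_nth)
  have "subdegree (fps_exp 1 - 1 :: 'a fps) \<le> 1"
    using nth1 by (rule subdegree_leI)
  then have "(fps_exp 1 - 1 :: 'a fps) dvd fps_X"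
    using nz by (subst fps_dvd_iff) auto
  then show ?thesis unfolding bernoulli_gf_def by simp
qed

definition bernoulli :: "nat \<Rightarrow> 'a :: field_char_0" where
  "bernoulli n = fact n * fps_nth bernoulli_gf n"

(* gen_bernpoly m n t is the value B_n^(m)(t). *)
definition gen_bernpoly :: "nat \<Rightarrow> nat \<Rightarrow> 'a :: field_char_0 \<Rightarrow> 'a" where
  "gen_bernpoly m n t = fact n * fps_nth (bernoulli_gf ^ m * fps_exp t) n"

(* calB m is the polynomial of index 2m+2, in the variable phi. *)
definition calB :: "nat \<Rightarrow> complex poly" where
  "calB m = smult (- (2 ^ (2*m+1)))
     (\<Sum>k=0..m+1. monom
        ((2 * of_real pi * \<i>) ^ (2*k)
          * (bernoulli (2*k) / fact (2*k))
          * (gen_bernpoly (2*m+2) (2*m+2-2*k) (of_nat (m+1)) / fact (2*m+2-2*k)))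
        (2*m+2-2*k))"

end

(* Write b = x/(e^x - 1), N = 2m+2 and H = b^N e^{(m+1)x}. The series b + x/2 is even, so the sum
   is the coefficient of x^N in (b + x/2) H. From x b' = b - b^2 - x b one gets
   x H' = N (H - (b + x/2) H), and the coefficient of x^N in H - x H'/N is 0. *)
theory Submission
  imports Defs
begin

lemma fps_exp_1_minus_1_neq_0: "fps_exp 1 - 1 \<noteq> (0 :: 'a :: field_char_0 fps)"
proof -
  have "fps_nth (fps_exp 1 - 1 :: 'a fps) 1 \<noteq> 0" by simp
  then show ?thesis by (metis fps_zero_nth)
qed

lemma bernoulli_gf_mult_exp:
  "bernoulli_gf * fps_exp 1 = bernoulli_gf + (fps_X :: 'a :: field_char_0 fps)"
  using bernoulli_gf_mult[where 'a = 'a] by (simp add: algebra_simps)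

text \<open>Differentiating b (e^x - 1) = x gives b' (e^x - 1) + b e^x = 1. Multiplying by b turns
  the first term into x b', and b e^x = b + x removes the exponential.\<close>

lemma fps_X_deriv_bernoulli_gf:
  "fps_X * fps_deriv bernoulli_gf =
     bernoulli_gf - bernoulli_gf\<^sup>2 - fps_X * (bernoulli_gf :: 'a :: field_char_0 fps)"
proof -
  let ?b = "bernoulli_gf :: 'a fps"
  have "fps_deriv (?b * (fps_exp 1 - 1)) = 1"
    by (simp add: bernoulli_gf_mult)
  then have d: "fps_deriv ?b * (fps_exp 1 - 1) + ?b * fps_exp 1 = 1"
    by (simp add: algebra_simps)
  have "fps_X * fps_deriv ?b = ?b * (fps_deriv ?b * (fps_exp 1 - 1))"
    by (simp only: bernoulli_gf_mult[symmetric] mult_ac)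
  also have "\<dots> = ?b * (1 - ?b * fps_exp 1)"
    using d by (simp add: eq_diff_eq)
  also have "\<dots> = ?b - ?b\<^sup>2 - fps_X * ?b"
    by (simp add: bernoulli_gf_mult_exp power2_eq_square algebra_simps)
  finally show ?thesis .
qed

text \<open>This is b(-x) = b(x) + x, the source of the parity of b + x/2. Both sides agree after
  multiplication by the nonzero series e^x - 1.\<close>

lemma bernoulli_gf_compose_uminus:
  "fps_compose bernoulli_gf (fps_const (-1) * fps_X) =
     bernoulli_gf + (fps_X :: 'a :: field_char_0 fps)"
proof -
  let ?b = "bernoulli_gf :: 'a fps" and ?E = "fps_exp 1 :: 'a fps"
  let ?c = "fps_compose ?b (fps_const (-1) * fps_X)"
  have E: "fps_compose ?E (fps_const (-1) * fps_X) = fps_exp (-1)"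
    by (simp only: fps_compose_linear) (simp add: fps_eq_iff)
  have "fps_compose (?b * (?E - 1)) (fps_const (-1) * fps_X) = fps_const (-1) * fps_X"
    by (simp add: bernoulli_gf_mult)
  then have "?c * (fps_exp (-1) - 1) = - fps_X"
    by (simp add: fps_compose_mult_distrib fps_compose_sub_distrib E
             del: fps_const_neg fps_const_1_eq_1)
  \<comment> \<open>The factor e^x turns e^(-x) - 1 back into a multiple of the denominator of
    b.\<close>
  moreover have "(fps_exp (-1) - 1) * ?E = - (?E - 1)"
    using fps_exp_add_mult[of "-1" "1 :: 'a"] by (simp add: algebra_simps)
  ultimately have "?c * - (?E - 1) = - fps_X * ?E"
    by (metis mult.assoc)
  then have "?c * (?E - 1) = fps_X * ?E"
    by (simp only: mult_minus_left mult_minus_right neg_equal_iff_equal)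
  also have "\<dots> = ?b * ?E * (?E - 1)"
    by (simp only: bernoulli_gf_mult[symmetric] mult_ac)
  also have "\<dots> = (?b + fps_X) * (?E - 1)"
    by (simp only: bernoulli_gf_mult_exp)
  finally show ?thesis
    using fps_exp_1_minus_1_neq_0 by simp
qed

text \<open>Comparing odd coefficients in b(-x) = b(x) + x gives 2 b_n + [n = 1] = 0, so adding x/2
  cancels the only nonzero odd coefficient, the one in degree 1.\<close>

lemma bernoulli_gf_plus_half_X_nth_odd:
  assumes "odd n"
  shows "fps_nth (bernoulli_gf + fps_const (1/2) * fps_X :: 'a :: field_char_0 fps) n = 0"
proof -
  let ?b = "bernoulli_gf :: 'a fps"
  have "(-1) ^ n * fps_nth ?b n = fps_nth (?b + fps_X) n"
    unfolding bernoulli_gf_compose_uminus[symmetric] fps_compose_linear by simp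
  then have "- fps_nth ?b n = fps_nth ?b n + fps_nth fps_X n"
    using assms by simp
  then have "2 * fps_nth ?b n + fps_nth fps_X n = 0"
    by (simp add: algebra_simps add_eq_0_iff)
  then have "2 * (fps_nth ?b n + fps_nth fps_X n / 2) = 0"
    by (simp only: distrib_left) simp
  then show ?thesis by (simp only: fps_add_nth fps_mult_left_const_nth mult_eq_0_iff) simp
qed

lemma bernoulli_gf_plus_half_X_nth_even:
  "fps_nth (bernoulli_gf + fps_const (1/2) * fps_X :: 'a :: field_char_0 fps) (2*k) =
     bernoulli (2*k) / fact (2*k)"
  by (simp add: bernoulli_def fps_X_nth)

lemma sum_atMost_double_even:
  fixes f :: "nat \<Rightarrow> 'a :: comm_monoid_add"
  assumes "\<And>j. odd j \<Longrightarrow> f j = 0"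
  shows "(\<Sum>j=0..2*n. f j) = (\<Sum>k=0..n. f (2*k))"
  using assms by (induction n) (simp_all add: add.assoc)

text \<open>The argument n is half the order 2n: the factor e^(nx) then contributes n x H to x H',
  which is exactly what changes b + x into b + x/2.\<close>

lemma bernoulli_gf_power_exp_nth_eq_0:
  fixes n :: nat
  assumes "n > 0"
  defines "H \<equiv> bernoulli_gf ^ (2*n) * fps_exp (of_nat n) :: 'a :: field_char_0 fps"
  shows "fps_nth ((bernoulli_gf + fps_const (1/2) * fps_X) * H) (2*n) = 0"
proof -
  let ?b = "bernoulli_gf :: 'a fps" and ?N = "2 * of_nat n :: 'a fps"
  have half: "2 * (fps_const (1/2) * fps_X) = (fps_X :: 'a fps)"
    by (simp add: fps_eq_iff numeral_fps_const mult.assoc[symmetric] del: fps_const_mult)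
  \<comment> \<open>Abstracting x/2 to any \<open>h\<close> with \<open>2 * h = x\<close> leaves a
    pure ring identity, free of the constant 1/2.\<close>
  have split: "?N * (1 - ?b - x) * H + of_nat n * x * H = ?N * (H - (?b + h) * H)"
    if "2 * h = x" for h x
    by (simp add: that[symmetric] algebra_simps)
  have "fps_deriv H = ?N * ?b ^ (2*n - 1) * fps_deriv ?b * fps_exp (of_nat n) + of_nat n * H"
    by (simp add: H_def fps_deriv_power' fps_of_nat algebra_simps)
  then have "fps_X * fps_deriv H =
      ?N * ?b ^ (2*n - 1) * (fps_X * fps_deriv ?b) * fps_exp (of_nat n) + of_nat n * fps_X * H"
    by (simp add: algebra_simps)
  also have "fps_X * fps_deriv ?b = ?b * (1 - ?b - fps_X)"
    by (simp add: fps_X_deriv_bernoulli_gf power2_eq_square algebra_simps)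
  also have "?N * ?b ^ (2*n - 1) * (?b * (1 - ?b - fps_X)) * fps_exp (of_nat n) =
      ?N * (1 - ?b - fps_X) * (?b ^ (2*n - 1) * ?b * fps_exp (of_nat n))"
    by (simp only: mult_ac)
  \<comment> \<open>Here n > 0 ensures that the truncated exponent 2n - 1 is a true
    predecessor.\<close>
  also have "?b ^ (2*n - 1) * ?b * fps_exp (of_nat n) = H"
    using power_minus_mult[of "2*n" ?b] assms(1) by (simp add: H_def)
  also have "?N * (1 - ?b - fps_X) * H + of_nat n * fps_X * H =
      ?N * (H - (?b + fps_const (1/2) * fps_X) * H)"
    by (rule split[OF half])
  finally have eq: "fps_X * fps_deriv H = of_nat (2*n) * (H - (?b + fps_const (1/2) * fps_X) * H)"
    by simp
  \<comment> \<open>The operator x d/dx multiplies the coefficient of x^(2n) by 2n, the same factor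
    as on the right of \<open>eq\<close>, so the coefficients of H cancel.\<close>
  have "fps_nth (fps_X * fps_deriv H) (2*n) = of_nat (2*n) * fps_nth H (2*n)"
    using assms(1) by simp
  moreover have "fps_nth (of_nat (2*n) * (H - (?b + fps_const (1/2) * fps_X) * H)) (2*n) =
      of_nat (2*n) * (fps_nth H (2*n) - fps_nth ((?b + fps_const (1/2) * fps_X) * H) (2*n))"
    by (simp only: fps_of_nat[symmetric] fps_mult_left_const_nth fps_sub_nth)
  ultimately have "(of_nat (2*n) :: 'a) * fps_nth ((?b + fps_const (1/2) * fps_X) * H) (2*n) = 0"
    unfolding eq by (simp only: right_diff_distrib) simp
  then show ?thesis using assms(1) by simp
qed

text \<open>The vanishing coefficient is expanded as a Cauchy product. Evenness of b + x/2 removes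
  the odd indices, and in even degrees its coefficients are those of b.\<close>

lemma bernoulli_gen_bernpoly_sum_eq_0:
  fixes n :: nat
  assumes "n > 0"
  shows "(\<Sum>k=0..n. (bernoulli (2*k) * gen_bernpoly (2*n) (2*n - 2*k) (of_nat n))
            / (fact (2*k) * fact (2*n - 2*k))) = (0 :: 'a :: field_char_0)"
proof -
  let ?e = "bernoulli_gf + fps_const (1/2) * fps_X :: 'a fps"
  let ?H = "bernoulli_gf ^ (2*n) * fps_exp (of_nat n) :: 'a fps"
  have "0 = (\<Sum>j=0..2*n. fps_nth ?e j * fps_nth ?H (2*n - j))"
    using bernoulli_gf_power_exp_nth_eq_0[OF assms, where 'a = 'a] unfolding fps_mult_nth[of ?e] by simp
  also have "\<dots> = (\<Sum>k=0..n. fps_nth ?e (2*k) * fps_nth ?H (2*n - 2*k))"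
    by (intro sum_atMost_double_even) (metis bernoulli_gf_plus_half_X_nth_odd mult_zero_left)
  also have "\<dots> = (\<Sum>k=0..n. (bernoulli (2*k) * gen_bernpoly (2*n) (2*n - 2*k) (of_nat n))
            / (fact (2*k) * fact (2*n - 2*k)))"
    by (simp only: bernoulli_gf_plus_half_X_nth_even) (simp add: gen_bernpoly_def)
  finally show ?thesis by simp
qed

text \<open>Only even powers of \<phi> occur, so fixing the square of \<phi> makes every term a
  multiple of the same power of 2 pi i. The hypothesis on squares treats both signs at once.\<close>

lemma poly_calB:
  assumes "\<phi>\<^sup>2 = (2 * of_real pi * \<i>)\<^sup>2"
  shows "poly (calB m) \<phi> = - (2 ^ (2*m+1)) * (2 * of_real pi * \<i>) ^ (2*m+2) *
    (\<Sum>k=0..m+1. (bernoulli (2*k) * gen_bernpoly (2*m+2) (2*m+2-2*k) (of_nat (m+1)))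
       / (fact (2*k) * fact (2*m+2-2*k)))"
proof -
  let ?w = "2 * of_real pi * \<i> :: complex"
  have "?w ^ (2*k) * x * \<phi> ^ (2*m+2-2*k) = ?w ^ (2*m+2) * x" if "k \<le> m+1" for k x
  proof -
    \<comment> \<open>The exponent is written as an explicit double so that \<phi> enters only
      through its square.\<close>
    have "2*m+2-2*k = 2*(m+1-k)" using that by simp
    then have "\<phi> ^ (2*m+2-2*k) = ?w ^ (2*m+2-2*k)"
      using assms by (simp only: power_mult)
    moreover have "?w ^ (2*k) * ?w ^ (2*m+2-2*k) = ?w ^ (2*m+2)"
      unfolding power_add[symmetric] using that by simp
    ultimately show ?thesis by (simp only: mult.commute[of _ x] mult.assoc)
  qed
  note pow = this
  have "poly (calB m) \<phi> = - (2 ^ (2*m+1)) *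
      (\<Sum>k=0..m+1. ?w ^ (2*k) * ((bernoulli (2*k) / fact (2*k)) *
        (gen_bernpoly (2*m+2) (2*m+2-2*k) (of_nat (m+1)) / fact (2*m+2-2*k))) * \<phi> ^ (2*m+2-2*k))"
    by (simp only: calB_def poly_smult poly_sum poly_monom mult.assoc)
  also have "\<dots> = - (2 ^ (2*m+1)) * (\<Sum>k=0..m+1. ?w ^ (2*m+2) * ((bernoulli (2*k) / fact (2*k)) *
        (gen_bernpoly (2*m+2) (2*m+2-2*k) (of_nat (m+1)) / fact (2*m+2-2*k))))"
    by (intro arg_cong2[where f = "(*)"] refl sum.cong pow) simp
  finally show ?thesis
    by (simp only: sum_distrib_left[symmetric] times_divide_times_eq mult.assoc)
qed

theorem mainTheorem8:
  fixes m :: nat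
  shows "poly (calB m) (2 * of_real pi * \<i>) = 0
       \<and> poly (calB m) (- (2 * of_real pi * \<i>)) = 0
       \<and> (\<Sum>k=0..m+1.
            (bernoulli (2*k) * gen_bernpoly (2*m+2) (2*m+2-2*k) (of_nat (m+1)))
              / (fact (2*k) * fact (2*m+2-2*k))) = (0 :: complex)"
proof -
  have "2 * (m+1) = 2*m+2" by simp
  then have sum: "(\<Sum>k=0..m+1.
            (bernoulli (2*k) * gen_bernpoly (2*m+2) (2*m+2-2*k) (of_nat (m+1)))
              / (fact (2*k) * fact (2*m+2-2*k))) = (0 :: complex)"
    using bernoulli_gen_bernpoly_sum_eq_0[of "m+1", where 'a = complex] by (simp only:)
  \<comment> \<open>Both points satisfy the hypothesis of \<open>poly_calB\<close>, the negative one
    by \<open>power2_minus\<close>, so both values are multiples of the zero sum.\<close>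
  show ?thesis
    by (simp only: poly_calB power2_minus sum mult_zero_right simp_thms)
qed

end
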